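(* Suppose that $D^0=0$ and $D^k-D^{k-1}=1$ for all $k\in\mathcal K$. Let $\overline{CP_1}$ and $\overline{CP_2}$ be the LP relaxations of $(CP_1)$ and $(CP_2)$ respectively. Then $v(\overline{CP_1})\ge v(\overline{CP_2})$.
   Context: An instance of the $p$-center problem consists of positive integers $N$ (number of clients $C_1,\dots,C_N$), $M$ (number of potential facility sites $F_1,\dots,F_M$) and $p$, and of distances $d_{ij}\ge 0$ between client $C_i$ and site $F_j$ for $i\in\mathcal N=\{1,\dots,N\}$, $j\in\mathcal M=\{1,\dots,M\}$. Let $D^0<D^1<\dots<D^K$ be the distinct values taken by the $d_{ij}$, with $K\ge 1$, and $\mathcal K=\{1,\dots,K\}$. For $i\in\mathcal N$ and $k\in\mathcal K$, let $N_i^k$ be the set of facilities located at distance less than $D^k$ from client $C_i$, i.e. those with $d_{ij}<D^k$. Let $S_i$ be the set of indices $k\in\{1,\dots,K-1\}$ such that $N_i^k\ne N_i^{k+1}$. Formulation $(CP_1)$ is the 0-1 program with variables $y_j$ ($j\in\mathcal M$) and $z^k$ ($k\in\mathcal K$): $$\min\ D^0+\sum_{k=1}^K (D^k-D^{k-1})\,z^k$$ subject to $$1\le \sum_{j=1}^M y_j\le p,\qquad z^k\ge z^{k+1}\quad (k\in\{1,\dots,K-1\}),$$ $$z^k+\sum_{j\,:\,d_{ij}<D^k} y_j\ge 1\quad (i\in\mathcal N,\ k\in S_i\cup\{K\}),\qquad y_j,z^k\in\{0,1\}\quad (j\in\mathcal M,\ k\in\mathcal K).$$ Formulation $(CP_2)$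 is the integer program with variables $y_j$ ($j\in\mathcal M$) and $r$: $$\min\ r$$ subject to $$1\le \sum_{j=1}^M y_j\le p,\qquad r+k\sum_{j\,:\,d_{ij}<D^k} y_j\ge k\quad (i\in\mathcal N,\ k\in S_i\cup\{K\}),$$ $$y_j\in\{0,1\}\quad (j\in\mathcal M),\qquad r\in\{0,\dots,K\}.$$ In the LP relaxations, the integrality constraints $y_j\in\{0,1\}$, $z^k\in\{0,1\}$, $r\in\{0,\dots,K\}$ are replaced by $y_j\in[0,1]$, $z^k\in[0,1]$, $r\in[0,K]$. $v(\cdot)$ denotes the optimal value of a linear program. *)

theory Defs
  imports Complex_Main "HOL-Library.Extended_Real" "HOL-Library.FuncSet"
begin

text \<open>
  Clients are indexed by \<open>{1..N}\<close> and sites by \<open>{1..M}\<close>; \<open>d i j\<close> is the distance between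
  client \<open>i\<close> and site \<open>j\<close>, and \<open>D 0 < \<dots> < D K\<close> enumerates the distinct distances.
\<close>

definition p_center_instance ::
  "nat \<Rightarrow> nat \<Rightarrow> nat \<Rightarrow> (nat \<Rightarrow> nat \<Rightarrow> real) \<Rightarrow> nat \<Rightarrow> (nat \<Rightarrow> real) \<Rightarrow> bool" where
  "p_center_instance N M p d K D \<longleftrightarrow>
     N \<ge> 1 \<and> M \<ge> 1 \<and> p \<ge> 1 \<and>
     (\<forall>i\<in>{1..N}. \<forall>j\<in>{1..M}. d i j \<ge> 0) \<and>
     K \<ge> 1 \<and> strict_mono_on {0..K} D \<and>
     D ` {0..K} = {d i j | i j. i \<in> {1..N} \<and> j \<in> {1..M}}"

definition near :: "nat \<Rightarrow> (nat \<Rightarrow> nat \<Rightarrow> real) \<Rightarrow> (nat \<Rightarrow> real) \<Rightarrow> nat \<Rightarrow> nat \<Rightarrow> nat set" where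
  "near M d D i k = {j \<in> {1..M}. d i j < D k}"

definition S_set :: "nat \<Rightarrow> (nat \<Rightarrow> nat \<Rightarrow> real) \<Rightarrow> nat \<Rightarrow> (nat \<Rightarrow> real) \<Rightarrow> nat \<Rightarrow> nat set" where
  "S_set M d K D i = {k \<in> {1..<K}. near M d D i k \<noteq> near M d D i (k + 1)}"

text \<open>
  The feasible sets are parametrised by the ranges \<open>Y\<close>, \<open>Z\<close>, \<open>R\<close> of the variables, so that
  a 0-1 (or integer) program and its LP relaxation differ only in these ranges.
  Vectors over \<open>{1..M}\<close> and \<open>{1..K}\<close> are extensional functions.
\<close>

definition cp1_feasible ::
  "nat \<Rightarrow> nat \<Rightarrow> nat \<Rightarrow> (nat \<Rightarrow> nat \<Rightarrow> real) \<Rightarrow> nat \<Rightarrow> (nat \<Rightarrow> real) \<Rightarrow>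
   real set \<Rightarrow> real set \<Rightarrow> ((nat \<Rightarrow> real) \<times> (nat \<Rightarrow> real)) set" where
  "cp1_feasible N M p d K D Y Z =
     {(y, z). y \<in> {1..M} \<rightarrow>\<^sub>E Y \<and> z \<in> {1..K} \<rightarrow>\<^sub>E Z \<and>
        1 \<le> (\<Sum>j\<in>{1..M}. y j) \<and> (\<Sum>j\<in>{1..M}. y j) \<le> real p \<and>
        (\<forall>k\<in>{1..<K}. z k \<ge> z (k + 1)) \<and>
        (\<forall>i\<in>{1..N}. \<forall>k\<in>S_set M d K D i \<union> {K}. z k + (\<Sum>j\<in>near M d D i k. y j) \<ge> 1)}"

definition cp1_objective ::
  "nat \<Rightarrow> (nat \<Rightarrow> real) \<Rightarrow> (nat \<Rightarrow> real) \<times> (nat \<Rightarrow> real) \<Rightarrow> real" where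
  "cp1_objective K D = (\<lambda>(y, z). D 0 + (\<Sum>k\<in>{1..K}. (D k - D (k - 1)) * z k))"

definition cp2_feasible ::
  "nat \<Rightarrow> nat \<Rightarrow> nat \<Rightarrow> (nat \<Rightarrow> nat \<Rightarrow> real) \<Rightarrow> nat \<Rightarrow> (nat \<Rightarrow> real) \<Rightarrow>
   real set \<Rightarrow> real set \<Rightarrow> ((nat \<Rightarrow> real) \<times> real) set" where
  "cp2_feasible N M p d K D Y R =
     {(y, r). y \<in> {1..M} \<rightarrow>\<^sub>E Y \<and> r \<in> R \<and>
        1 \<le> (\<Sum>j\<in>{1..M}. y j) \<and> (\<Sum>j\<in>{1..M}. y j) \<le> real p \<and>
        (\<forall>i\<in>{1..N}. \<forall>k\<in>S_set M d K D i \<union> {K}.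
           r + real k * (\<Sum>j\<in>near M d D i k. y j) \<ge> real k)}"

definition cp2_objective :: "(nat \<Rightarrow> real) \<times> real \<Rightarrow> real" where
  "cp2_objective = (\<lambda>(y, r). r)"

definition CP1 where
  "CP1 N M p d K D = cp1_feasible N M p d K D {0, 1} {0, 1}"

definition CP1_relaxed where
  "CP1_relaxed N M p d K D = cp1_feasible N M p d K D {0..1} {0..1}"

definition CP2 where
  "CP2 N M p d K D = cp2_feasible N M p d K D {0, 1} (real ` {0..K})"

definition CP2_relaxed where
  "CP2_relaxed N M p d K D = cp2_feasible N M p d K D {0..1} {0..real K}"

text \<open>
  The value of a minimisation problem is an infimum in the extended reals:
  \<open>\<infinity>\<close> if infeasible, \<open>-\<infinity>\<close> if unbounded, and the attained minimum otherwise for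
  a linear program.
\<close>

definition optimal_value :: "('a \<Rightarrow> real) \<Rightarrow> 'a set \<Rightarrow> ereal" where
  "optimal_value f X = (INF x\<in>X. ereal (f x))"

end

theory Submission
  imports Defs
begin

text \<open>
  If \<open>(y, z)\<close> is feasible for the first relaxation, then \<open>(y, r)\<close> with \<open>r = z\<^sub>1 + \<dots> + z\<^sub>K\<close> is
  feasible for the second and has the same objective value: as \<open>z\<close> is nonincreasing and
  nonnegative, \<open>r \<ge> k z\<^sub>k\<close>, so \<open>r + k \<Sum> y\<^sub>j \<ge> k (z\<^sub>k + \<Sum> y\<^sub>j) \<ge> k\<close>.
\<close>

text \<open>Each of the first \<open>k\<close> terms of the sum is at least \<open>z k\<close>, and
  the terms after them are nonnegative.\<close>

lemma nonincreasing_mult_le_sum: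
  fixes z :: "nat \<Rightarrow> real"
  assumes dec: "\<forall>k\<in>{1..<K}. z k \<ge> z (k + 1)"
    and nonneg: "\<forall>k\<in>{1..K}. z k \<ge> 0"
    and k: "k \<in> {1..K}"
  shows "real k * z k \<le> (\<Sum>l\<in>{1..K}. z l)"
proof -
  have le: "z k \<le> z l" if "l \<in> {1..k}" for l
  proof -
    have "l \<le> k" using that by simp
    then show ?thesis
    \<comment> \<open>Induction downward from \<open>k\<close>, because \<open>dec\<close> only
      compares neighbouring entries.\<close>
    proof (induction l rule: inc_induct)
      case base
      show ?case by simp
    next
      case (step m)
      then have "m \<in> {1..<K}"
        using that k by auto
      with dec step.IH show ?case by fastforce
    qed
  qed
  have "real k * z k = (\<Sum>l\<in>{1..k}. z k)" by simp
  also have "\<dots> \<le> (\<Sum>l\<in>{1..k}. z l)" by (rule sum_mono) (rule le)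
  also have "\<dots> \<le> (\<Sum>l\<in>{1..K}. z l)"
    using k nonneg by (intro sum_mono2) auto
  finally show ?thesis .
qed

lemma CP1_relaxed_imp_CP2_relaxed:
  assumes K: "K \<ge> 1" and feas: "(y, z) \<in> CP1_relaxed N M p d K D"
  shows "(y, \<Sum>k\<in>{1..K}. z k) \<in> CP2_relaxed N M p d K D"
proof -
  have z: "z k \<in> {0..1}" if "k \<in> {1..K}" for k
    using feas that unfolding CP1_relaxed_def cp1_feasible_def by (auto simp: PiE_iff)
  have dec: "\<forall>k\<in>{1..<K}. z k \<ge> z (k + 1)"
    using feas unfolding CP1_relaxed_def cp1_feasible_def by auto
  have cover: "z k + (\<Sum>j\<in>near M d D i k. y j) \<ge> 1"
    if "i \<in> {1..N}" "k \<in> S_set M d K D i \<union> {K}" for i k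
    using feas that unfolding CP1_relaxed_def cp1_feasible_def by auto
  \<comment> \<open>Bounding each \<open>z k\<close> by 1 keeps the sum within the upper limit
    \<open>K\<close> on \<open>r\<close>.\<close>
  have "(\<Sum>k\<in>{1..K}. z k) \<le> real (card {1..K}) * 1"
    by (rule sum_bounded_above) (use z in auto)
  then have range: "(\<Sum>k\<in>{1..K}. z k) \<in> {0..real K}"
    using z by (auto intro!: sum_nonneg)
  have "(\<Sum>l\<in>{1..K}. z l) + real k * (\<Sum>j\<in>near M d D i k. y j) \<ge> real k"
    if i: "i \<in> {1..N}" and k: "k \<in> S_set M d K D i \<union> {K}" for i k
  proof -
    \<comment> \<open>\<open>K \<ge> 1\<close> is what places the extra index \<open>K\<close> in
      this range.\<close>
    have "k \<in> {1..K}" using k K by (auto simp: S_set_def)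
    then have "real k * z k \<le> (\<Sum>l\<in>{1..K}. z l)"
      using dec z by (intro nonincreasing_mult_le_sum) auto
    moreover have "real k * 1 \<le> real k * (z k + (\<Sum>j\<in>near M d D i k. y j))"
      using cover[OF i k] by (intro mult_left_mono) auto
    ultimately show ?thesis by (simp add: distrib_left)
  qed
  then show ?thesis
    using feas range unfolding CP1_relaxed_def cp1_feasible_def CP2_relaxed_def cp2_feasible_def
    by auto
qed

theorem proposition5:
  fixes N M p K :: nat and d :: "nat \<Rightarrow> nat \<Rightarrow> real" and D :: "nat \<Rightarrow> real"
  assumes "p_center_instance N M p d K D"
    and "D 0 = 0"
    and "\<forall>k\<in>{1..K}. D k - D (k - 1) = 1"
  shows "optimal_value (cp1_objective K D) (CP1_relaxed N M p d K D)
           \<ge> optimal_value cp2_objective (CP2_relaxed N M p d K D)"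
  unfolding optimal_value_def
proof (rule INF_mono)
  \<comment> \<open>The infima are compared point by point, which also covers an empty feasible set,
    of value \<infinity>.\<close>
  fix x assume x: "x \<in> CP1_relaxed N M p d K D"
  obtain y z where yz: "x = (y, z)" by (cases x)
  let ?r = "\<Sum>k\<in>{1..K}. z k"
  have "K \<ge> 1" using assms(1) by (simp add: p_center_instance_def)
  then have "(y, ?r) \<in> CP2_relaxed N M p d K D"
    using x unfolding yz by (rule CP1_relaxed_imp_CP2_relaxed)
  \<comment> \<open>With \<open>D 0 = 0\<close> and unit gaps, the first objective is just the sum
    of the \<open>z k\<close>.\<close>
  moreover have "cp1_objective K D x = cp2_objective (y, ?r)"
    using assms(2,3) by (simp add: yz cp1_objective_def cp2_objective_def)
  ultimately show "\<exists>x'\<in>CP2_relaxed N M p d K D.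
      ereal (cp2_objective x') \<le> ereal (cp1_objective K D x)"
    by (metis order_refl)
qed

end
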